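(* Let $\mathsf{KH}_{\leq}$ be the category of compact ordered spaces and continuous monotone maps. The opposite category $\mathsf{KH}_{\leq}^{\mathrm{op}}$ is not equivalent to any $\mathrm{SP}$-class of finitary algebras.
   Context: A compact ordered space is a pair $(X,\leq)$ where $X$ is a compact space and $\leq$ is a partial order on $X$ which is closed in the product topology of $X\times X$ (it follows that $X$ is Hausdorff). An $\mathrm{SP}$-class of finitary algebras is a class of algebras, in a language all of whose function symbols have finite arity, which is closed under taking subalgebras and Cartesian products; it is regarded as a category with all homomorphisms as morphisms. *)

theory Defs
  imports "HOL-Analysis.Analysis"
begin

unbundle cardinal_syntax

subsection \<open>Categories and equivalence\<close>

text \<open>Hom-sets are indexed by pairs of objects and need not be disjoint; therefore composition and
  the arrow parts of functors take the objects involved as arguments.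
  \<open>Comp C a b c g f\<close> is the composite of \<open>f : a \<rightarrow> b\<close> followed by \<open>g : b \<rightarrow> c\<close>.\<close>

record ('o, 'm) category =
  Obj :: "'o set"
  Hom :: "'o \<Rightarrow> 'o \<Rightarrow> 'm set"
  Ident :: "'o \<Rightarrow> 'm"
  Comp :: "'o \<Rightarrow> 'o \<Rightarrow> 'o \<Rightarrow> 'm \<Rightarrow> 'm \<Rightarrow> 'm"

definition is_category :: "('o, 'm) category \<Rightarrow> bool" where
  "is_category C \<longleftrightarrow>
     (\<forall>a\<in>Obj C. Ident C a \<in> Hom C a a) \<and>
     (\<forall>a\<in>Obj C. \<forall>b\<in>Obj C. \<forall>c\<in>Obj C. \<forall>f\<in>Hom C a b. \<forall>g\<in>Hom C b c.
        Comp C a b c g f \<in> Hom C a c) \<and>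
     (\<forall>a\<in>Obj C. \<forall>b\<in>Obj C. \<forall>f\<in>Hom C a b.
        Comp C a a b f (Ident C a) = f \<and> Comp C a b b (Ident C b) f = f) \<and>
     (\<forall>a\<in>Obj C. \<forall>b\<in>Obj C. \<forall>c\<in>Obj C. \<forall>d\<in>Obj C.
        \<forall>f\<in>Hom C a b. \<forall>g\<in>Hom C b c. \<forall>h\<in>Hom C c d.
        Comp C a c d h (Comp C a b c g f) = Comp C a b d (Comp C b c d h g) f)"

definition opposite :: "('o, 'm) category \<Rightarrow> ('o, 'm) category" where
  "opposite C = \<lparr>Obj = Obj C, Hom = (\<lambda>a b. Hom C b a), Ident = Ident C,
     Comp = (\<lambda>a b c g f. Comp C c b a f g)\<rparr>"

definition is_functor ::
  "('o, 'm) category \<Rightarrow> ('p, 'n) category \<Rightarrow> ('o \<Rightarrow> 'p) \<Rightarrow> ('o \<Rightarrow> 'o \<Rightarrow> 'm \<Rightarrow> 'n) \<Rightarrow> bool" where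
  "is_functor C D Fo Fm \<longleftrightarrow>
     (\<forall>a\<in>Obj C. Fo a \<in> Obj D) \<and>
     (\<forall>a\<in>Obj C. \<forall>b\<in>Obj C. \<forall>f\<in>Hom C a b. Fm a b f \<in> Hom D (Fo a) (Fo b)) \<and>
     (\<forall>a\<in>Obj C. Fm a a (Ident C a) = Ident D (Fo a)) \<and>
     (\<forall>a\<in>Obj C. \<forall>b\<in>Obj C. \<forall>c\<in>Obj C. \<forall>f\<in>Hom C a b. \<forall>g\<in>Hom C b c.
        Fm a c (Comp C a b c g f) = Comp D (Fo a) (Fo b) (Fo c) (Fm b c g) (Fm a b f))"

definition is_iso :: "('o, 'm) category \<Rightarrow> 'o \<Rightarrow> 'o \<Rightarrow> 'm \<Rightarrow> bool" where
  "is_iso C a b f \<longleftrightarrow> f \<in> Hom C a b \<and>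
     (\<exists>g\<in>Hom C b a. Comp C a b a g f = Ident C a \<and> Comp C b a b f g = Ident C b)"

definition natural_iso ::
  "('o, 'm) category \<Rightarrow> ('p, 'n) category \<Rightarrow> ('o \<Rightarrow> 'p) \<Rightarrow> ('o \<Rightarrow> 'o \<Rightarrow> 'm \<Rightarrow> 'n) \<Rightarrow>
     ('o \<Rightarrow> 'p) \<Rightarrow> ('o \<Rightarrow> 'o \<Rightarrow> 'm \<Rightarrow> 'n) \<Rightarrow> ('o \<Rightarrow> 'n) \<Rightarrow> bool" where
  "natural_iso C D Fo Fm Go Gm \<eta> \<longleftrightarrow>
     (\<forall>a\<in>Obj C. is_iso D (Fo a) (Go a) (\<eta> a)) \<and>
     (\<forall>a\<in>Obj C. \<forall>b\<in>Obj C. \<forall>f\<in>Hom C a b.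
        Comp D (Fo a) (Fo b) (Go b) (\<eta> b) (Fm a b f) =
        Comp D (Fo a) (Go a) (Go b) (Gm a b f) (\<eta> a))"

definition equivalent_categories :: "('o, 'm) category \<Rightarrow> ('p, 'n) category \<Rightarrow> bool" where
  "equivalent_categories C D \<longleftrightarrow>
     (\<exists>Fo Fm Go Gm \<eta> \<epsilon>.
        is_functor C D Fo Fm \<and> is_functor D C Go Gm \<and>
        natural_iso C C (\<lambda>a. a) (\<lambda>a b f. f)
          (\<lambda>a. Go (Fo a)) (\<lambda>a b f. Gm (Fo a) (Fo b) (Fm a b f)) \<eta> \<and>
        natural_iso D D (\<lambda>a. Fo (Go a)) (\<lambda>a b f. Fm (Go a) (Go b) (Gm a b f))
          (\<lambda>a. a) (\<lambda>a b f. f) \<epsilon>)"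

lemma is_category_concrete:
  assumes id: "\<And>a. a \<in> Ob \<Longrightarrow> (\<lambda>x\<in>U a. x) \<in> H a a"
    and comp: "\<And>a b c f g. a \<in> Ob \<Longrightarrow> f \<in> H a b \<Longrightarrow> g \<in> H b c \<Longrightarrow> compose (U a) g f \<in> H a c"
    and maps: "\<And>a b f. f \<in> H a b \<Longrightarrow> f \<in> U a \<rightarrow>\<^sub>E U b"
  shows "is_category \<lparr>Obj = Ob, Hom = H, Ident = (\<lambda>a. \<lambda>x\<in>U a. x),
    Comp = (\<lambda>a b c g f. compose (U a) g f)\<rparr>"
proof -
  have ext: "f \<in> U a \<rightarrow> U b" "f \<in> extensional (U a)" if "f \<in> H a b" for a b f
    using maps[OF that] by (auto simp: PiE_iff)
  show ?thesis
    unfolding is_category_def category.simps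
    by (intro conjI ballI id comp)
       (assumption | rule compose_Id Id_compose compose_assoc | erule ext)+
qed

lemma is_category_opposite: "is_category C \<Longrightarrow> is_category (opposite C)"
  by (simp add: is_category_def opposite_def)

subsection \<open>Smallness\<close>

text \<open>HOL cannot quantify over the proper class of all spaces, so a type plays the role of a
  universe, and ``set'' means a subset of it of smaller cardinality. If the cardinality \<open>\<kappa>\<close> of the
  type is strongly inaccessible, these are, up to bijection, exactly the members of the
  Grothendieck universe \<open>V\<^sub>\<kappa>\<close>. Inaccessibility is not built in, and spaces and algebras may live in
  different universes.\<close>

definition small :: "'u set \<Rightarrow> bool" where
  "small A \<longleftrightarrow> |A| <o |UNIV :: 'u set|"

subsection \<open>Compact ordered spaces\<close>

type_synonym 'u ordered_space = "'u topology \<times> 'u rel"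

definition compact_ordered_space :: "'u ordered_space \<Rightarrow> bool" where
  "compact_ordered_space = (\<lambda>(T, r). compact_space T \<and>
     partial_order_on (topspace T) r \<and> closedin (prod_topology T T) r)"

text \<open>Arrows are extensional (constantly \<open>undefined\<close> off the carrier of the domain), so that
  functions equal on the carrier are equal arrows.\<close>

definition KH_le_Hom :: "'u ordered_space \<Rightarrow> 'u ordered_space \<Rightarrow> ('u \<Rightarrow> 'u) set" where
  "KH_le_Hom = (\<lambda>(S, r) (T, s). {f. f \<in> extensional (topspace S) \<and> continuous_map S T f \<and>
     monotone_on (topspace S) (\<lambda>x y. (x, y) \<in> r) (\<lambda>x y. (x, y) \<in> s) f})"

definition KH_le :: "('u ordered_space, 'u \<Rightarrow> 'u) category" where
  "KH_le = \<lparr>Obj = {X. compact_ordered_space X \<and> small (topspace (fst X))},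
     Hom = KH_le_Hom,
     Ident = (\<lambda>X. \<lambda>x\<in>topspace (fst X). x),
     Comp = (\<lambda>X Y Z g f. compose (topspace (fst X)) g f)\<rparr>"

lemma is_category_KH_le: "is_category KH_le"
proof -
  have id: "(\<lambda>x\<in>topspace (fst X). x) \<in> KH_le_Hom X X" for X :: "'u ordered_space"
  proof (cases X)
    case (Pair S r)
    have "continuous_map S S (\<lambda>x\<in>topspace S. x)"
      by (rule continuous_map_eq[OF continuous_map_id]) simp
    then show ?thesis
      by (auto simp: Pair KH_le_Hom_def monotone_on_def)
  qed
  have comp: "compose (topspace (fst X)) g f \<in> KH_le_Hom X Z"
    if "f \<in> KH_le_Hom X Y" "g \<in> KH_le_Hom Y Z" for X Y Z :: "'u ordered_space" and f g
  proof -
    obtain S r T s U t where XYZ: "X = (S, r)" "Y = (T, s)" "Z = (U, t)"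
      by (metis surj_pair)
    have "continuous_map S T f" "continuous_map T U g"
      using that by (auto simp: XYZ KH_le_Hom_def)
    then have "continuous_map S U (g \<circ> f)"
      by (rule continuous_map_compose)
    then have "continuous_map S U (compose (topspace S) g f)"
      by (rule continuous_map_eq) (simp add: compose_eq)
    moreover have "f x \<in> topspace T" if "x \<in> topspace S" for x
      using \<open>continuous_map S T f\<close> that by (auto simp: continuous_map_def)
    ultimately show ?thesis
      using that by (auto simp: XYZ KH_le_Hom_def monotone_on_def compose_eq)
  qed
  have maps: "f \<in> topspace (fst X) \<rightarrow>\<^sub>E topspace (fst Y)"
    if "f \<in> KH_le_Hom X Y" for X Y :: "'u ordered_space" and f
    using that by (auto simp: KH_le_Hom_def continuous_map_def PiE_def split: prod.splits)
  show ?thesis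
    unfolding KH_le_def by (rule is_category_concrete[OF id comp maps])
qed

subsection \<open>SP-classes of finitary algebras\<close>

text \<open>A language is a set \<open>\<Sigma>\<close> of function symbols with an arity function; a symbol of arity \<open>n\<close> is
  interpreted on lists of length \<open>n\<close>.\<close>

record ('f, 'a) alg =
  carr :: "'a set"
  interp :: "'f \<Rightarrow> 'a list \<Rightarrow> 'a"

definition is_algebra :: "'f set \<Rightarrow> ('f \<Rightarrow> nat) \<Rightarrow> ('f, 'a) alg \<Rightarrow> bool" where
  "is_algebra \<Sigma> ar A \<longleftrightarrow>
     (\<forall>s\<in>\<Sigma>. \<forall>xs. length xs = ar s \<and> set xs \<subseteq> carr A \<longrightarrow> interp A s xs \<in> carr A)"

definition alg_Hom ::
  "'f set \<Rightarrow> ('f \<Rightarrow> nat) \<Rightarrow> ('f, 'a) alg \<Rightarrow> ('f, 'b) alg \<Rightarrow> ('a \<Rightarrow> 'b) set" where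
  "alg_Hom \<Sigma> ar A B = {h. h \<in> carr A \<rightarrow>\<^sub>E carr B \<and>
     (\<forall>s\<in>\<Sigma>. \<forall>xs. length xs = ar s \<and> set xs \<subseteq> carr A \<longrightarrow>
        h (interp A s xs) = interp B s (map h xs))}"

definition alg_isomorphic ::
  "'f set \<Rightarrow> ('f \<Rightarrow> nat) \<Rightarrow> ('f, 'a) alg \<Rightarrow> ('f, 'b) alg \<Rightarrow> bool" where
  "alg_isomorphic \<Sigma> ar A B \<longleftrightarrow> (\<exists>h\<in>alg_Hom \<Sigma> ar A B. bij_betw h (carr A) (carr B))"

definition subalgebra ::
  "'f set \<Rightarrow> ('f \<Rightarrow> nat) \<Rightarrow> ('f, 'a) alg \<Rightarrow> ('f, 'a) alg \<Rightarrow> bool" where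
  "subalgebra \<Sigma> ar B A \<longleftrightarrow> is_algebra \<Sigma> ar B \<and> carr B \<subseteq> carr A \<and>
     (\<forall>s\<in>\<Sigma>. \<forall>xs. length xs = ar s \<and> set xs \<subseteq> carr B \<longrightarrow> interp B s xs = interp A s xs)"

definition product_alg :: "'i set \<Rightarrow> ('i \<Rightarrow> ('f, 'a) alg) \<Rightarrow> ('f, 'i \<Rightarrow> 'a) alg" where
  "product_alg I A = \<lparr>carr = (\<Pi>\<^sub>E i\<in>I. carr (A i)),
     interp = (\<lambda>s xs. \<lambda>i\<in>I. interp (A i) s (map (\<lambda>x. x i) xs))\<rparr>"

text \<open>The elements of a product are functions, so closure under products is expressed by means of
  the isomorphic copies of the product inside the universe; taking one-element families, this
  includes closure under isomorphism. Only nonempty subalgebras are required to belong to the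
  class, while the empty algebra is allowed to; hence both conventions, algebras with possibly
  empty carriers and algebras with nonempty carriers, are covered.\<close>

definition SP_class :: "'f set \<Rightarrow> ('f \<Rightarrow> nat) \<Rightarrow> ('f, 'v) alg set \<Rightarrow> bool" where
  "SP_class \<Sigma> ar K \<longleftrightarrow>
     (\<forall>A\<in>K. is_algebra \<Sigma> ar A \<and> small (carr A)) \<and>
     (\<forall>A\<in>K. \<forall>B. subalgebra \<Sigma> ar B A \<and> carr B \<noteq> {} \<longrightarrow> B \<in> K) \<and>
     (\<forall>(I :: 'v set) A B. small I \<and> (\<forall>i\<in>I. A i \<in> K) \<and> is_algebra \<Sigma> ar B \<and> small (carr B) \<and>
        alg_isomorphic \<Sigma> ar B (product_alg I A) \<longrightarrow> B \<in> K)"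

definition alg_category ::
  "'f set \<Rightarrow> ('f \<Rightarrow> nat) \<Rightarrow> ('f, 'v) alg set \<Rightarrow> (('f, 'v) alg, 'v \<Rightarrow> 'v) category" where
  "alg_category \<Sigma> ar K = \<lparr>Obj = K, Hom = alg_Hom \<Sigma> ar,
     Ident = (\<lambda>A. \<lambda>x\<in>carr A. x),
     Comp = (\<lambda>A B C g f. compose (carr A) g f)\<rparr>"

lemma is_category_alg_category:
  assumes "SP_class \<Sigma> ar K"
  shows "is_category (alg_category \<Sigma> ar K)"
proof -
  have alg: "is_algebra \<Sigma> ar A" if "A \<in> K" for A
    using assms[unfolded SP_class_def, THEN conjunct1] that by simp
  have id: "(\<lambda>x\<in>carr A. x) \<in> alg_Hom \<Sigma> ar A A" if "A \<in> K" for A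
  proof -
    note alg[OF that]
    moreover have "map (\<lambda>x\<in>carr A. x) xs = xs" if "set xs \<subseteq> carr A" for xs
      using that by (intro map_idI) auto
    ultimately show ?thesis
      by (auto simp: alg_Hom_def is_algebra_def)
  qed
  have comp: "compose (carr A) g f \<in> alg_Hom \<Sigma> ar A C"
    if "A \<in> K" "f \<in> alg_Hom \<Sigma> ar A B" "g \<in> alg_Hom \<Sigma> ar B C" for A B C f g
  proof -
    have f: "f \<in> carr A \<rightarrow>\<^sub>E carr B" and g: "g \<in> carr B \<rightarrow>\<^sub>E carr C"
      using that by (auto simp: alg_Hom_def)
    have "compose (carr A) g f (interp A s xs) = interp C s (map (compose (carr A) g f) xs)"
      if s: "s \<in> \<Sigma>" and xs: "length xs = ar s" "set xs \<subseteq> carr A" for s xs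
    proof -
      have "interp A s xs \<in> carr A"
        using alg[OF \<open>A \<in> K\<close>] s xs by (simp add: is_algebra_def)
      then have "compose (carr A) g f (interp A s xs) = g (f (interp A s xs))"
        by (simp add: compose_eq)
      also have "\<dots> = g (interp B s (map f xs))"
        using \<open>f \<in> alg_Hom \<Sigma> ar A B\<close> s xs by (simp add: alg_Hom_def)
      also have "\<dots> = interp C s (map g (map f xs))"
      proof -
        have "set (map f xs) \<subseteq> carr B"
          using f xs by (auto simp: PiE_iff)
        moreover have "length (map f xs) = ar s"
          using xs by simp
        ultimately show ?thesis
          using \<open>g \<in> alg_Hom \<Sigma> ar B C\<close> s unfolding alg_Hom_def by blast
      qed
      also have "map g (map f xs) = map (compose (carr A) g f) xs"
        using xs by (auto simp: compose_eq subset_iff)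
      finally show ?thesis .
    qed
    moreover have "compose (carr A) g f \<in> carr A \<rightarrow>\<^sub>E carr C"
      using f g by (auto simp: compose_eq PiE_iff compose_extensional)
    ultimately show ?thesis
      by (auto simp: alg_Hom_def)
  qed
  have maps: "f \<in> carr A \<rightarrow>\<^sub>E carr B" if "f \<in> alg_Hom \<Sigma> ar A B" for A B f
    using that by (simp add: alg_Hom_def)
  show ?thesis
    unfolding alg_category_def by (rule is_category_concrete[OF id comp maps])
qed

end

theory Submission
  imports Defs
begin

text \<open>
  Let \<open>F\<close> be an equivalence from the opposite of the category of compact ordered spaces to an
  SP-class, and let \<open>I\<close> be the unit interval ordered by equality, so that every continuous map
  \<open>I \<rightarrow> I\<close> is an arrow. The algebra \<open>A = F I\<close> is acted on, contravariantly, by the continuous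
  endomaps of \<open>I\<close>. The clipping maps \<open>t \<mapsto> max c t\<close> with \<open>c > 0\<close> are idempotent endomaps of \<open>I\<close>, and
  \<open>I\<close> is their inverse limit as \<open>c\<close> tends to \<open>0\<close>: a family of arrows \<open>q c : Z \<rightarrow> I\<close> compatible with
  clipping is the family of clippings of one arrow \<open>Z \<rightarrow> I\<close> (\<open>clip_limit\<close>).

  Finitariness enters as follows. The images of the clipping maps acting on \<open>A\<close> increase as \<open>c\<close>
  decreases. Since operations take only finitely many arguments, the union \<open>B\<close> of these images is a
  subalgebra of \<open>A\<close> (\<open>stable_subalgebra\<close>), hence belongs to the class and is isomorphic to \<open>F Z\<close> for
  some \<open>Z\<close>. As \<open>F\<close> turns the inverse limit \<open>I\<close> into a colimit, the corestrictions \<open>A \<rightarrow> B\<close> of the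
  clipping maps induce a section \<open>A \<rightarrow> B\<close> of the inclusion, so \<open>B = A\<close> (\<open>interval_stable\<close>): every
  element of \<open>A\<close> is fixed by clipping at some \<open>c > 0\<close>.

  Now let the constant map with value \<open>t\<close> act on \<open>a \<in> A\<close>, which amounts to evaluating \<open>a\<close> at the
  point \<open>t\<close>. If \<open>a\<close> is fixed by clipping at \<open>c\<close>, its value at any \<open>t \<le> c\<close> is its value at \<open>c\<close>; so the
  value is constant near \<open>0\<close>. Letting translations and reflections act on \<open>a\<close> first carries this to
  any other point of \<open>I\<close>: the value is locally constant on the connected set \<open>[0,1]\<close>, thus constant
  (\<open>point_values_constant\<close>). Consequently the constant maps \<open>0\<close> and \<open>1\<close> act in the same way on \<open>A\<close>,
  which contradicts the faithfulness of \<open>F\<close>.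
\<close>

section \<open>Equivalences of categories\<close>

definition fully_faithful ::
  "('o, 'm) category \<Rightarrow> ('p, 'n) category \<Rightarrow> ('o \<Rightarrow> 'p) \<Rightarrow> ('o \<Rightarrow> 'o \<Rightarrow> 'm \<Rightarrow> 'n) \<Rightarrow> bool" where
  "fully_faithful C D Fo Fm \<longleftrightarrow>
     (\<forall>a\<in>Obj C. \<forall>b\<in>Obj C. bij_betw (Fm a b) (Hom C a b) (Hom D (Fo a) (Fo b)))"

definition essentially_surjective ::
  "('o, 'm) category \<Rightarrow> ('p, 'n) category \<Rightarrow> ('o \<Rightarrow> 'p) \<Rightarrow> bool" where
  "essentially_surjective C D Fo \<longleftrightarrow> (\<forall>d\<in>Obj D. \<exists>c\<in>Obj C. \<exists>\<beta>. is_iso D (Fo c) d \<beta>)"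

lemma category_comp_in_Hom:
  assumes "is_category C" "a \<in> Obj C" "b \<in> Obj C" "c \<in> Obj C" "f \<in> Hom C a b" "g \<in> Hom C b c"
  shows "Comp C a b c g f \<in> Hom C a c"
  using assms unfolding is_category_def by blast

lemma category_comp_assoc:
  assumes "is_category C" "a \<in> Obj C" "b \<in> Obj C" "c \<in> Obj C" "d \<in> Obj C"
    and "f \<in> Hom C a b" "g \<in> Hom C b c" "h \<in> Hom C c d"
  shows "Comp C a c d h (Comp C a b c g f) = Comp C a b d (Comp C b c d h g) f"
  using assms unfolding is_category_def by blast

lemma category_comp_ident:
  assumes "is_category C" "a \<in> Obj C" "b \<in> Obj C" "f \<in> Hom C a b"
  shows "Comp C a a b f (Ident C a) = f" "Comp C a b b (Ident C b) f = f"
  using assms unfolding is_category_def by blast+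

lemma iso_left_cancel:
  assumes C: "is_category C" and ob: "a \<in> Obj C" "b \<in> Obj C" "e \<in> Obj C"
    and "is_iso C b e h" and f: "f \<in> Hom C a b" and f': "f' \<in> Hom C a b"
    and eq: "Comp C a b e h f = Comp C a b e h f'"
  shows "f = f'"
proof -
  obtain g where h: "h \<in> Hom C b e" and g: "g \<in> Hom C e b" "Comp C b e b g h = Ident C b"
    using \<open>is_iso C b e h\<close> unfolding is_iso_def by blast
  have "Comp C a e b g (Comp C a b e h k) = k" if "k \<in> Hom C a b" for k
    using category_comp_assoc[OF C ob(1,2,3,2) that h g(1)] g(2)
      category_comp_ident(2)[OF C ob(1,2) that] by simp
  then show ?thesis
    using f f' eq by metis
qed

lemma iso_right_cancel:
  assumes C: "is_category C" and ob: "a \<in> Obj C" "b \<in> Obj C" "e \<in> Obj C"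
    and "is_iso C a b h" and f: "f \<in> Hom C b e" and f': "f' \<in> Hom C b e"
    and eq: "Comp C a b e f h = Comp C a b e f' h"
  shows "f = f'"
proof -
  obtain g where h: "h \<in> Hom C a b" and g: "g \<in> Hom C b a" "Comp C b a b h g = Ident C b"
    using \<open>is_iso C a b h\<close> unfolding is_iso_def by blast
  have "Comp C b a e (Comp C a b e k h) g = k" if "k \<in> Hom C b e" for k
    using category_comp_assoc[OF C ob(2,1,2,3) g(1) h that] g(2)
      category_comp_ident(1)[OF C ob(2,3) that] by simp
  then show ?thesis
    using f f' eq by metis
qed

text \<open>By naturality of the unit, an arrow is determined by its image under \<open>G F\<close>, because the components
  of the unit can be cancelled.\<close>

lemma faithful_if_left_inverse:
  assumes C: "is_category C" and F: "is_functor C D Fo Fm" and G: "is_functor D C Go Gm"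
    and \<eta>: "natural_iso C C (\<lambda>a. a) (\<lambda>a b f. f)
              (\<lambda>a. Go (Fo a)) (\<lambda>a b f. Gm (Fo a) (Fo b) (Fm a b f)) \<eta>"
    and ob: "a \<in> Obj C" "b \<in> Obj C" and f: "f \<in> Hom C a b" "f' \<in> Hom C a b"
    and eq: "Fm a b f = Fm a b f'"
  shows "f = f'"
proof (rule iso_left_cancel[OF C ob])
  show "Go (Fo b) \<in> Obj C"
    using F G ob unfolding is_functor_def by blast
  show "is_iso C b (Go (Fo b)) (\<eta> b)"
    using \<eta> ob unfolding natural_iso_def by blast
  have "Comp C a b (Go (Fo b)) (\<eta> b) k =
      Comp C a (Go (Fo a)) (Go (Fo b)) (Gm (Fo a) (Fo b) (Fm a b k)) (\<eta> a)"
    if "k \<in> Hom C a b" for k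
    using \<eta> ob that unfolding natural_iso_def by blast
  with f eq show "Comp C a b (Go (Fo b)) (\<eta> b) f = Comp C a b (Go (Fo b)) (\<eta> b) f'"
    by simp
qed (use f in auto)

lemma faithful_if_right_inverse:
  assumes D: "is_category D" and F: "is_functor C D Fo Fm" and G: "is_functor D C Go Gm"
    and \<epsilon>: "natural_iso D D (\<lambda>a. Fo (Go a)) (\<lambda>a b f. Fm (Go a) (Go b) (Gm a b f))
              (\<lambda>a. a) (\<lambda>a b f. f) \<epsilon>"
    and ob: "a \<in> Obj D" "b \<in> Obj D" and f: "f \<in> Hom D a b" "f' \<in> Hom D a b"
    and eq: "Gm a b f = Gm a b f'"
  shows "f = f'"
proof (rule iso_right_cancel[OF D _ ob])
  show "Fo (Go a) \<in> Obj D"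
    using F G ob unfolding is_functor_def by blast
  show "is_iso D (Fo (Go a)) a (\<epsilon> a)"
    using \<epsilon> ob unfolding natural_iso_def by blast
  have "Comp D (Fo (Go a)) (Fo (Go b)) b (\<epsilon> b) (Fm (Go a) (Go b) (Gm a b k)) =
      Comp D (Fo (Go a)) a b k (\<epsilon> a)"
    if "k \<in> Hom D a b" for k
    using \<epsilon> ob that unfolding natural_iso_def by blast
  with f eq show "Comp D (Fo (Go a)) a b f (\<epsilon> a) = Comp D (Fo (Go a)) a b f' (\<epsilon> a)"
    by metis
qed (use f in auto)

text \<open>For fullness, an arrow \<open>h : F a \<rightarrow> F b\<close> is hit by the conjugate of \<open>G h\<close> with the unit: both \<open>h\<close>
  and the image of the conjugate have the same image under \<open>G\<close>, which is faithful by the counit.\<close>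

lemma equivalence_fully_faithful_essentially_surjective:
  assumes C: "is_category C" and D: "is_category D" and "equivalent_categories C D"
  obtains Fo Fm where "is_functor C D Fo Fm" "fully_faithful C D Fo Fm"
    "essentially_surjective C D Fo"
proof -
  obtain Fo Fm Go Gm \<eta> \<epsilon> where
    F: "is_functor C D Fo Fm" and G: "is_functor D C Go Gm" and
    \<eta>: "natural_iso C C (\<lambda>a. a) (\<lambda>a b f. f)
          (\<lambda>a. Go (Fo a)) (\<lambda>a b f. Gm (Fo a) (Fo b) (Fm a b f)) \<eta>" and
    \<epsilon>: "natural_iso D D (\<lambda>a. Fo (Go a)) (\<lambda>a b f. Fm (Go a) (Go b) (Gm a b f))
          (\<lambda>a. a) (\<lambda>a b f. f) \<epsilon>"
    using assms(3) unfolding equivalent_categories_def by blast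
  have Fob: "Fo a \<in> Obj D" if "a \<in> Obj C" for a
    using F that unfolding is_functor_def by blast
  have Fhom: "Fm a b f \<in> Hom D (Fo a) (Fo b)"
    if "a \<in> Obj C" "b \<in> Obj C" "f \<in> Hom C a b" for a b f
    using F that unfolding is_functor_def by blast
  have Gob: "Go a \<in> Obj C" if "a \<in> Obj D" for a
    using G that unfolding is_functor_def by blast
  have Ghom: "Gm a b f \<in> Hom C (Go a) (Go b)"
    if "a \<in> Obj D" "b \<in> Obj D" "f \<in> Hom D a b" for a b f
    using G that unfolding is_functor_def by blast
  have "bij_betw (Fm a b) (Hom C a b) (Hom D (Fo a) (Fo b))"
    if a: "a \<in> Obj C" and b: "b \<in> Obj C" for a b
  proof (rule bij_betw_imageI)
    show "inj_on (Fm a b) (Hom C a b)"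
      by (intro inj_onI faithful_if_left_inverse[OF C F G \<eta> a b])
    have "h \<in> Fm a b ` Hom C a b" if h: "h \<in> Hom D (Fo a) (Fo b)" for h
    proof -
      let ?a = "Go (Fo a)" and ?b = "Go (Fo b)"
      note obs = Gob[OF Fob[OF a]] Gob[OF Fob[OF b]]
      have isoa: "is_iso C a ?a (\<eta> a)" and isob: "is_iso C b ?b (\<eta> b)"
        using \<eta> a b unfolding natural_iso_def by blast+
      obtain \<theta> where \<theta>: "\<theta> \<in> Hom C ?b b" "Comp C ?b b ?b (\<eta> b) \<theta> = Ident C ?b"
        using isob unfolding is_iso_def by blast
      have \<eta>a: "\<eta> a \<in> Hom C a ?a" and \<eta>b: "\<eta> b \<in> Hom C b ?b"
        using isoa isob unfolding is_iso_def by blast+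
      note Gh = Ghom[OF Fob[OF a] Fob[OF b] h]
      define k where "k = Comp C a ?a ?b (Gm (Fo a) (Fo b) h) (\<eta> a)"
      have k: "k \<in> Hom C a ?b"
        unfolding k_def using category_comp_in_Hom[OF C a obs \<eta>a Gh] .
      define f where "f = Comp C a ?b b \<theta> k"
      have f: "f \<in> Hom C a b"
        unfolding f_def using category_comp_in_Hom[OF C a obs(2) b k \<theta>(1)] .
      have "Comp C a b ?b (\<eta> b) f = k"
        unfolding f_def using category_comp_assoc[OF C a obs(2) b obs(2) k \<theta>(1) \<eta>b] \<theta>(2)
          category_comp_ident(2)[OF C a obs(2) k] by simp
      moreover have "Comp C a b ?b (\<eta> b) f = Comp C a ?a ?b (Gm (Fo a) (Fo b) (Fm a b f)) (\<eta> a)"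
        using \<eta> a b f unfolding natural_iso_def by blast
      ultimately have "Gm (Fo a) (Fo b) (Fm a b f) = Gm (Fo a) (Fo b) h"
        using iso_right_cancel[OF C a obs isoa Ghom[OF Fob[OF a] Fob[OF b] Fhom[OF a b f]] Gh]
        unfolding k_def by simp
      then have "Fm a b f = h"
        by (intro faithful_if_right_inverse[OF D F G \<epsilon> Fob[OF a] Fob[OF b] Fhom[OF a b f] h])
      with f show ?thesis
        by blast
    qed
    then show "Fm a b ` Hom C a b = Hom D (Fo a) (Fo b)"
      using Fhom[OF a b] by blast
  qed
  then have "fully_faithful C D Fo Fm"
    unfolding fully_faithful_def by blast
  moreover have "essentially_surjective C D Fo"
    using \<epsilon> Gob unfolding essentially_surjective_def natural_iso_def by blast
  ultimately show thesis
    using that F by blast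
qed

lemma KH_le_sel:
  "Hom KH_le = KH_le_Hom"
  "Ident KH_le X = (\<lambda>x\<in>topspace (fst X). x)"
  "Comp KH_le X Y Z g f = compose (topspace (fst X)) g f"
  by (simp_all add: KH_le_def)

section \<open>The unit interval ordered by equality\<close>

text \<open>Spaces are carried by subsets of the universe \<open>'u\<close>, so the interval has to be transported along
  an injection of the reals into \<open>'u\<close>; that it is a small set is where the size of \<open>'u\<close> matters.\<close>

locale interval_copy =
  fixes emb :: "real \<Rightarrow> 'u"
  assumes inj_emb: "inj emb"
    and continuum_small: "|UNIV :: real set| <o |UNIV :: 'u set|"
begin

abbreviation val :: "'u \<Rightarrow> real" where
  "val \<equiv> inv emb"

definition pts :: "'u set" where
  "pts = emb ` {0..1}"

definition interval :: "'u ordered_space" where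
  "interval = (pullback_topology pts val euclideanreal, Id_on pts)"

definition lift :: "(real \<Rightarrow> real) \<Rightarrow> 'u \<Rightarrow> 'u" where
  "lift f = (\<lambda>x\<in>pts. emb (f (val x)))"

lemma val_emb [simp]: "val (emb t) = t"
  using inj_emb by simp

lemma emb_val: "x \<in> pts \<Longrightarrow> emb (val x) = x"
  by (auto simp: pts_def)

lemma val_range: "x \<in> pts \<Longrightarrow> val x \<in> {0..1}"
  by (auto simp: pts_def)

lemma emb_pts [simp]: "emb t \<in> pts \<longleftrightarrow> t \<in> {0..1}"
  using inj_emb by (simp add: pts_def inj_image_mem_iff)

lemma topspace_interval [simp]: "topspace (fst interval) = pts"
  by (simp add: interval_def topspace_pullback_topology)

lemma snd_interval [simp]: "snd interval = Id_on pts"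
  by (simp add: interval_def)

lemma continuous_map_emb:
  "continuous_map (top_of_set {0..1}) (fst interval) emb"
  unfolding interval_def fst_conv
  by (rule continuous_map_pullback') (auto simp: o_def)

lemma continuous_map_val: "continuous_map (fst interval) euclideanreal val"
  unfolding interval_def fst_conv
  using continuous_map_pullback[OF continuous_map_id, of pts val euclideanreal] by simp

lemma interval_Obj: "interval \<in> Obj KH_le"
proof -
  have "compactin (fst interval) (emb ` {0..1})"
    by (rule image_compactin[OF _ continuous_map_emb]) (simp add: compactin_subtopology)
  then have compact: "compact_space (fst interval)"
    by (simp add: compact_space_def pts_def)
  have "Hausdorff_space (fst interval)"
  proof (rule Hausdorff_space_injective_preimage[OF Hausdorff_space_euclidean continuous_map_val])
    show "inj_on val (topspace (fst interval))"
      unfolding topspace_interval by (rule inj_on_inverseI) (rule emb_val)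
  qed
  then have "closedin (prod_topology (fst interval) (fst interval)) ((\<lambda>x. (x, x)) ` pts)"
    by (simp add: Hausdorff_space_closedin_diagonal)
  moreover have "(\<lambda>x. (x, x)) ` pts = Id_on pts"
    by auto
  moreover have "partial_order_on pts (Id_on pts)"
    by (auto simp: partial_order_on_def preorder_on_def refl_on_def trans_def antisym_def)
  ultimately have "compact_ordered_space interval"
    using compact unfolding compact_ordered_space_def case_prod_beta by simp
  moreover have "small pts"
  proof -
    have "|pts| \<le>o |{0..1::real}|"
      unfolding pts_def by (rule card_of_image)
    also have "|{0..1::real}| \<le>o |UNIV :: real set|"
      by (rule card_of_mono1) simp
    finally show ?thesis
      unfolding small_def using continuum_small ordLeq_ordLess_trans by blast
  qed
  ultimately show ?thesis
    by (simp add: KH_le_def)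
qed

text \<open>Because the order of the interval is equality, a map into it is monotone iff it identifies
  comparable points.\<close>

lemma to_interval_iff:
  "p \<in> KH_le_Hom Z interval \<longleftrightarrow>
     p \<in> topspace (fst Z) \<rightarrow>\<^sub>E pts \<and> continuous_map (fst Z) euclideanreal (\<lambda>z. val (p z)) \<and>
     (\<forall>y\<in>topspace (fst Z). \<forall>z\<in>topspace (fst Z). (y, z) \<in> snd Z \<longrightarrow> p y = p z)"
  (is "?L \<longleftrightarrow> ?R")
proof (cases Z)
  case (Pair S r)
  have "continuous_map S (fst interval) p \<longleftrightarrow>
      p \<in> topspace S \<rightarrow> pts \<and> continuous_map S euclideanreal (\<lambda>z. val (p z))"
  proof (intro iffI conjI)
    assume c: "continuous_map S (fst interval) p"
    then show "p \<in> topspace S \<rightarrow> pts"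
      using continuous_map_funspace topspace_interval by metis
    show "continuous_map S euclideanreal (\<lambda>z. val (p z))"
      using continuous_map_compose[OF c continuous_map_val] by (simp add: o_def)
  next
    assume "p \<in> topspace S \<rightarrow> pts \<and> continuous_map S euclideanreal (\<lambda>z. val (p z))"
    then show "continuous_map S (fst interval) p"
      unfolding interval_def fst_conv
      by (intro continuous_map_pullback') (auto simp: o_def)
  qed
  moreover have "p \<in> KH_le_Hom Z interval \<longleftrightarrow> p \<in> extensional (topspace S) \<and>
      continuous_map S (fst interval) p \<and>
      (\<forall>y\<in>topspace S. \<forall>z\<in>topspace S. (y, z) \<in> r \<longrightarrow> (p y, p z) \<in> Id_on pts)"
    by (simp add: Pair KH_le_Hom_def interval_def monotone_on_def)
  moreover have "(p y, p z) \<in> Id_on pts \<longleftrightarrow> p y = p z"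
    if "p \<in> topspace S \<rightarrow> pts" "y \<in> topspace S" for y z
    using that by (simp add: Id_on_iff Pi_iff)
  ultimately show ?thesis
    unfolding Pair fst_conv snd_conv PiE_def by blast
qed

lemma lift_Hom:
  assumes "continuous_on {0..1} f" "f \<in> {0..1} \<rightarrow> {0..1}"
  shows "lift f \<in> KH_le_Hom interval interval"
proof -
  have "continuous_map (top_of_set {0..1}) euclideanreal f"
    using assms by simp
  moreover have "continuous_map (fst interval) (top_of_set {0..1}) val"
    using continuous_map_val val_range by (auto simp: continuous_map_in_subtopology)
  ultimately have "continuous_map (fst interval) euclideanreal (f \<circ> val)"
    by (rule continuous_map_compose[rotated])
  then have "continuous_map (fst interval) euclideanreal (\<lambda>z. val (lift f z))"
    by (rule continuous_map_eq) (simp add: lift_def)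
  moreover have "lift f \<in> pts \<rightarrow>\<^sub>E pts"
    using assms(2) val_range by (auto simp: lift_def Pi_iff)
  ultimately show ?thesis
    by (auto simp: to_interval_iff)
qed

lemma compose_lift:
  assumes "f \<in> {0..1} \<rightarrow> {0..1}"
  shows "compose pts (lift g) (lift f) = lift (\<lambda>t. g (f t))"
proof
  fix x
  show "compose pts (lift g) (lift f) x = lift (\<lambda>t. g (f t)) x"
    using assms val_range[of x] by (auto simp: compose_def lift_def Pi_iff restrict_def)
qed

lemma lift_eqD:
  assumes "lift f = lift g" "t \<in> {0..1}"
  shows "f t = g t"
proof -
  have "emb (f t) = emb (g t)"
    using fun_cong[OF assms(1), of "emb t"] assms(2) by (simp add: lift_def)
  then show ?thesis
    using inj_emb by (rule injD[rotated])
qed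

text \<open>Clipping at the midpoint of two different numbers moves the smaller one only.\<close>

lemma clip_determines:
  fixes s t :: real
  assumes "s \<in> {0..1}" "t \<in> {0..1}"
    and clip: "\<And>c. 0 < c \<Longrightarrow> c \<le> 1 \<Longrightarrow> max c s = max c t"
  shows "s = t"
proof (rule ccontr)
  assume "s \<noteq> t"
  then show False
    using assms(1,2) clip[of "(s + t) / 2"] by (auto simp: max_def split: if_splits)
qed

text \<open>The interval is the inverse limit of its clippings. The limit of a compatible family is the
  pointwise infimum; it is continuous because the set where it exceeds, or stays below, a bound is
  a union of such sets for the members of the family.\<close>

lemma clip_limit:
  assumes q: "\<And>c. 0 < c \<Longrightarrow> c \<le> 1 \<Longrightarrow> q c \<in> KH_le_Hom Z interval"
    and compat: "\<And>c d. 0 < c \<Longrightarrow> c \<le> d \<Longrightarrow> d \<le> 1 \<Longrightarrow>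
      compose (topspace (fst Z)) (lift (max d)) (q c) = q d"
  obtains p where "p \<in> KH_le_Hom Z interval"
    "\<And>c. 0 < c \<Longrightarrow> c \<le> 1 \<Longrightarrow> compose (topspace (fst Z)) (lift (max c)) p = q c"
proof -
  let ?Z = "topspace (fst Z)"
  define u where "u c z = val (q c z)" for c z
  have q_pts: "q c z \<in> pts" if "z \<in> ?Z" "0 < c" "c \<le> 1" for c z
    using q[OF that(2,3)] that(1) by (auto simp: to_interval_iff)
  have u_range: "0 \<le> u c z" "u c z \<le> 1" if "z \<in> ?Z" "0 < c" "c \<le> 1" for c z
    using val_range[OF q_pts[OF that]] by (auto simp: u_def)
  have u_max: "max d (u c z) = u d z" if "z \<in> ?Z" "0 < c" "c \<le> d" "d \<le> 1" for c d z
  proof -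
    have "lift (max d) (q c z) = q d z"
      using fun_cong[OF compat[OF that(2-)], of z] that(1) by (simp add: compose_eq)
    then have "emb (max d (u c z)) = q d z"
      using q_pts[of z c] that by (simp add: lift_def u_def)
    then show ?thesis
      unfolding u_def by (metis val_emb)
  qed
  define v where "v z = (INF c\<in>{0<..1}. u c z)" for z
  have v_le: "v z \<le> u c z" if "z \<in> ?Z" "0 < c" "c \<le> 1" for c z
    unfolding v_def
    by (rule cINF_lower) (use that u_range in \<open>auto intro!: bdd_belowI2[of _ 0]\<close>)
  have v_ge: "a \<le> v z" if "\<And>c. 0 < c \<Longrightarrow> c \<le> 1 \<Longrightarrow> a \<le> u c z" for a z
    unfolding v_def by (rule cINF_greatest) (use that in auto)
  have v_range: "0 \<le> v z" "v z \<le> 1" if "z \<in> ?Z" for z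
  proof -
    show "0 \<le> v z"
      by (rule v_ge) (rule u_range(1)[OF that])
    show "v z \<le> 1"
      using v_le[OF that, of 1] u_range(2)[OF that, of 1] by simp
  qed
  have v_max: "max d (v z) = u d z" if z: "z \<in> ?Z" and d: "0 < d" "d \<le> 1" for d z
  proof (cases "u d z > d")
    case True
    have "u d z \<le> u c z" if c: "0 < c" "c \<le> 1" for c
    proof (cases "c \<le> d")
      case le: True
      show ?thesis
        using u_max[OF z c(1) le d(2)] True by linarith
    next
      case False
      then show ?thesis
        using u_max[OF z d(1) _ c(2)] by linarith
    qed
    from v_ge[OF this] v_le[OF z d] have "v z = u d z"
      by (rule antisym[rotated])
    with True show ?thesis
      by simp
  next
    case False
    then have "u d z = d"
      using u_max[of z d d] z d by simp
    then show ?thesis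
      using v_le[OF z d] by simp
  qed
  have v_cont: "continuous_map (fst Z) euclideanreal v"
    unfolding continuous_map_upper_lower_semicontinuous_lt
  proof (intro conjI allI)
    fix a :: real
    have u_cont: "continuous_map (fst Z) euclideanreal (u c)" if "0 < c" "c \<le> 1" for c
      using q[OF that] unfolding to_interval_iff u_def by blast
    then have u_open: "openin (fst Z) {z \<in> ?Z. u c z > b}" "openin (fst Z) {z \<in> ?Z. u c z < b}"
      if "0 < c" "c \<le> 1" for b c
      using that unfolding continuous_map_upper_lower_semicontinuous_lt by blast+
    show "openin (fst Z) {z \<in> ?Z. v z > a}"
    proof (cases "a < 0")
      case True
      then have "v z > a" if "z \<in> ?Z" for z
        using v_range(1)[OF that] by simp
      then have "{z \<in> ?Z. v z > a} = ?Z"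
        by blast
      then show ?thesis
        by simp
    next
      case False
      have "v z > a \<longleftrightarrow> (\<exists>d\<in>{0<..1}. u d z > max a d)" if z: "z \<in> ?Z" for z
      proof
        assume "v z > a"
        then show "\<exists>d\<in>{0<..1}. u d z > max a d"
          (* Clipping below the positive value v z does not change it. *)
          using False v_range[OF z] v_max[OF z, of "v z / 2"] by (intro bexI[of _ "v z / 2"]) auto
      next
        assume "\<exists>d\<in>{0<..1}. u d z > max a d"
        then obtain d where "0 < d" "d \<le> 1" "u d z > max a d"
          by auto
        then show "v z > a"
          using v_max[OF z, of d] by linarith
      qed
      then have "{z \<in> ?Z. v z > a} = (\<Union>d\<in>{0<..1}. {z \<in> ?Z. u d z > max a d})"
        by blast
      then show ?thesis
        by (simp only:) (intro openin_Union, use u_open(1) in \<open>force simp del: max_less_iff_conj\<close>)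
    qed
    have "v z < a \<longleftrightarrow> (\<exists>d\<in>{0<..1}. u d z < a)" if z: "z \<in> ?Z" for z
    proof
      assume "v z < a"
      moreover define d where "d = min 1 (a / 2)"
      ultimately have "0 < d" "d \<le> 1" "d < a"
        using v_range(1)[OF z] by auto
      with \<open>v z < a\<close> show "\<exists>d\<in>{0<..1}. u d z < a"
        using v_max[OF z, of d] by (intro bexI[of _ d]) auto
    next
      assume "\<exists>d\<in>{0<..1}. u d z < a"
      then show "v z < a"
        using le_less_trans[OF v_le[OF z]] by auto
    qed
    then have "{z \<in> ?Z. v z < a} = (\<Union>d\<in>{0<..1}. {z \<in> ?Z. u d z < a})"
      by blast
    then show "openin (fst Z) {z \<in> ?Z. v z < a}"
      by (simp only:) (intro openin_Union, use u_open(2) in force)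
  qed
  show thesis
  proof
    show "(\<lambda>z\<in>?Z. emb (v z)) \<in> KH_le_Hom Z interval"
      unfolding to_interval_iff
    proof (intro conjI ballI impI)
      show "(\<lambda>z\<in>?Z. emb (v z)) \<in> ?Z \<rightarrow>\<^sub>E pts"
        using v_range by auto
      show "continuous_map (fst Z) euclideanreal (\<lambda>z. val ((\<lambda>z\<in>?Z. emb (v z)) z))"
        by (rule continuous_map_eq[OF v_cont]) simp
      fix y z
      assume "y \<in> ?Z" "z \<in> ?Z" "(y, z) \<in> snd Z"
      moreover from this have "u c y = u c z" if "0 < c" "c \<le> 1" for c
        using q[OF that] unfolding to_interval_iff u_def by metis
      then have "v y = v z"
        unfolding v_def by (intro INF_cong) auto
      ultimately show "(\<lambda>z\<in>?Z. emb (v z)) y = (\<lambda>z\<in>?Z. emb (v z)) z"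
        by simp
    qed
  next
    fix c :: real
    assume c: "0 < c" "c \<le> 1"
    show "compose ?Z (lift (max c)) (\<lambda>z\<in>?Z. emb (v z)) = q c"
    proof (rule extensionalityI[of _ ?Z])
      show "q c \<in> extensional ?Z"
        using q[OF c] by (auto simp: to_interval_iff PiE_iff)
      fix z
      assume z: "z \<in> ?Z"
      have "compose ?Z (lift (max c)) (\<lambda>z\<in>?Z. emb (v z)) z = emb (max c (v z))"
        using z v_range[OF z] by (simp add: compose_eq lift_def)
      also have "\<dots> = q c z"
        using v_max[OF z c] emb_val[OF q_pts[OF z c]] by (simp add: u_def)
      finally show "compose ?Z (lift (max c)) (\<lambda>z\<in>?Z. emb (v z)) z = q c z" .
    qed (rule compose_extensional)
  qed
qed

end

section \<open>Finitary operations and the interval\<close>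

text \<open>The properties of an equivalence that the argument uses; they turn
  out to be contradictory. Arrows of the opposite category are indexed by their reversed ends: an
  arrow \<open>f : X \<rightarrow> Y\<close> of spaces yields the homomorphism \<open>Fm Y X f\<close> from \<open>Fo Y\<close> to \<open>Fo X\<close>.\<close>

locale finitary_duality = interval_copy emb for emb :: "real \<Rightarrow> 'u" +
  fixes \<Sigma> :: "'f set" and ar :: "'f \<Rightarrow> nat" and K :: "('f, 'v) alg set"
    and Fo :: "'u ordered_space \<Rightarrow> ('f, 'v) alg"
    and Fm :: "'u ordered_space \<Rightarrow> 'u ordered_space \<Rightarrow> ('u \<Rightarrow> 'u) \<Rightarrow> 'v \<Rightarrow> 'v"
  assumes SP: "SP_class \<Sigma> ar K"
    and functorial: "is_functor (opposite KH_le) (alg_category \<Sigma> ar K) Fo Fm"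
    and ff: "fully_faithful (opposite KH_le) (alg_category \<Sigma> ar K) Fo Fm"
    and es: "essentially_surjective (opposite KH_le) (alg_category \<Sigma> ar K) Fo"
begin

abbreviation A :: "('f, 'v) alg" where
  "A \<equiv> Fo interval"

abbreviation act :: "(real \<Rightarrow> real) \<Rightarrow> 'v \<Rightarrow> 'v" where
  "act f \<equiv> Fm interval interval (lift f)"

lemma Fo_K: "X \<in> Obj KH_le \<Longrightarrow> Fo X \<in> K"
  using functorial by (simp add: is_functor_def opposite_def alg_category_def)

lemma Fm_bij:
  assumes "X \<in> Obj KH_le" "Y \<in> Obj KH_le"
  shows "bij_betw (Fm Y X) (KH_le_Hom X Y) (alg_Hom \<Sigma> ar (Fo Y) (Fo X))"
  using ff assms by (simp add: fully_faithful_def opposite_def alg_category_def KH_le_sel)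

lemma Fm_Hom:
  assumes "X \<in> Obj KH_le" "Y \<in> Obj KH_le" "f \<in> KH_le_Hom X Y"
  shows "Fm Y X f \<in> alg_Hom \<Sigma> ar (Fo Y) (Fo X)"
  using Fm_bij[OF assms(1,2)] assms(3) by (rule bij_betwE[THEN bspec])

lemma Fm_inj:
  assumes "X \<in> Obj KH_le" "Y \<in> Obj KH_le" "f \<in> KH_le_Hom X Y" "g \<in> KH_le_Hom X Y"
    and "Fm Y X f = Fm Y X g"
  shows "f = g"
  using Fm_bij[OF assms(1,2)] assms(3-) by (meson bij_betw_imp_inj_on inj_onD)

lemma Fm_full:
  assumes "X \<in> Obj KH_le" "Y \<in> Obj KH_le" "h \<in> alg_Hom \<Sigma> ar (Fo Y) (Fo X)"
  obtains f where "f \<in> KH_le_Hom X Y" "Fm Y X f = h"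
  using Fm_bij[OF assms(1,2)] assms(3) by (metis bij_betw_imp_surj_on imageE)

lemma Fm_compose:
  assumes "X \<in> Obj KH_le" "Y \<in> Obj KH_le" "Z \<in> Obj KH_le"
    and "f \<in> KH_le_Hom X Y" "g \<in> KH_le_Hom Y Z"
  shows "Fm Z X (compose (topspace (fst X)) g f) = compose (carr (Fo Z)) (Fm Y X f) (Fm Z Y g)"
  using functorial assms by (simp add: is_functor_def opposite_def alg_category_def KH_le_sel)

lemma Fm_ident:
  "X \<in> Obj KH_le \<Longrightarrow> Fm X X (\<lambda>x\<in>topspace (fst X). x) = (\<lambda>a\<in>carr (Fo X). a)"
  using functorial by (simp add: is_functor_def opposite_def alg_category_def KH_le_sel)

lemma KH_le_compose:
  assumes "X \<in> Obj KH_le" "Y \<in> Obj KH_le" "Z \<in> Obj KH_le"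
    and "f \<in> KH_le_Hom X Y" "g \<in> KH_le_Hom Y Z"
  shows "compose (topspace (fst X)) g f \<in> KH_le_Hom X Z"
  using category_comp_in_Hom[OF is_category_KH_le, of X Y Z f g] assms
  by (simp add: KH_le_sel)

lemma alg_compose:
  assumes "B \<in> K" "C \<in> K" "D \<in> K" "f \<in> alg_Hom \<Sigma> ar B C" "g \<in> alg_Hom \<Sigma> ar C D"
  shows "compose (carr B) g f \<in> alg_Hom \<Sigma> ar B D"
  using category_comp_in_Hom[OF is_category_alg_category[OF SP], of B C D f g] assms
  by (simp add: alg_category_def)

lemma act_Hom:
  assumes "continuous_on {0..1} f" "f \<in> {0..1} \<rightarrow> {0..1}"
  shows "act f \<in> alg_Hom \<Sigma> ar A A"
  by (intro Fm_Hom interval_Obj lift_Hom assms)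

lemma act_in_carr:
  assumes "continuous_on {0..1} f" "f \<in> {0..1} \<rightarrow> {0..1}" "a \<in> carr A"
  shows "act f a \<in> carr A"
  using act_Hom[OF assms(1,2)] assms(3) by (auto simp: alg_Hom_def)

lemma act_act:
  assumes "continuous_on {0..1} f" "f \<in> {0..1} \<rightarrow> {0..1}"
    and "continuous_on {0..1} g" "g \<in> {0..1} \<rightarrow> {0..1}" and "a \<in> carr A"
  shows "act f (act g a) = act (\<lambda>t. g (f t)) a"
  using fun_cong[OF Fm_compose[OF interval_Obj interval_Obj interval_Obj
        lift_Hom[OF assms(1,2)] lift_Hom[OF assms(3,4)]], of a] assms(5)
  by (simp add: compose_lift[OF assms(2)] compose_eq)

lemma clip_maps: "continuous_on {0..1::real} (max c)" "0 \<le> c \<Longrightarrow> c \<le> 1 \<Longrightarrow> max c \<in> {0..1} \<rightarrow> {0..1::real}"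
  by (auto intro!: continuous_intros)

lemma clip_clip:
  assumes "0 \<le> c" "c \<le> 1" "0 \<le> d" "d \<le> 1" "a \<in> carr A"
  shows "act (max c) (act (max d) a) = act (max (max c d)) a"
proof -
  have "(\<lambda>t. max d (max c t)) = max (max c d)"
    by (simp add: fun_eq_iff max.assoc max.commute max.left_commute)
  then show ?thesis
    using act_act[OF clip_maps(1) clip_maps(2) clip_maps(1) clip_maps(2), of c d a] assms by simp
qed

text \<open>Clipping acts idempotently, so the elements fixed by clipping at some positive level are the union
  of the images of the clipping maps.\<close>

definition stable :: "('f, 'v) alg" where
  "stable = A\<lparr>carr := {a \<in> carr A. \<exists>c. 0 < c \<and> c \<le> 1 \<and> act (max c) a = a}\<rparr>"

lemma carr_stable: "carr stable = {a \<in> carr A. \<exists>c. 0 < c \<and> c \<le> 1 \<and> act (max c) a = a}"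
  by (simp add: stable_def)

lemma stable_mono:
  assumes "a \<in> carr A" "0 < c" "c \<le> d" "d \<le> 1" "act (max d) a = a"
  shows "act (max c) a = a"
  using clip_clip[of c d a] assms by (simp add: max_absorb2)

text \<open>Here finite arity is used: finitely many levels have a positive minimum.\<close>

lemma stable_list:
  "set xs \<subseteq> carr stable \<Longrightarrow> \<exists>c. 0 < c \<and> c \<le> 1 \<and> map (act (max c)) xs = xs"
proof (induction xs)
  case Nil
  show ?case
    by (auto intro: exI[of _ 1])
next
  case (Cons x xs)
  then obtain c d where c: "0 < c" "c \<le> 1" "map (act (max c)) xs = xs"
    and d: "0 < d" "d \<le> 1" "act (max d) x = x"
    by (auto simp: carr_stable)
  have "act (max (min c d)) y = y" if "y \<in> set xs" for y
    using stable_mono[of y "min c d" c] c d that Cons.prems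
    by (auto simp: carr_stable map_eq_conv[of _ xs id, simplified])
  moreover have "act (max (min c d)) x = x"
    using stable_mono[of x "min c d" d] c d Cons.prems by (auto simp: carr_stable)
  ultimately show ?case
    using c d by (intro exI[of _ "min c d"]) (auto intro: map_idI)
qed

lemma stable_subalgebra: "subalgebra \<Sigma> ar stable A"
proof -
  have A: "is_algebra \<Sigma> ar A"
    using SP[unfolded SP_class_def, THEN conjunct1] Fo_K[OF interval_Obj] by simp
  have "interp A s xs \<in> carr stable"
    if s: "s \<in> \<Sigma>" "length xs = ar s" and xs: "set xs \<subseteq> carr stable" for s xs
  proof -
    obtain c where c: "0 < c" "c \<le> 1" "map (act (max c)) xs = xs"
      using stable_list[OF xs] by blast
    have xsA: "set xs \<subseteq> carr A"
      using xs by (auto simp: carr_stable)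
    have "act (max c) (interp A s xs) = interp A s (map (act (max c)) xs)"
      using act_Hom[OF clip_maps(1) clip_maps(2), of c] c s xsA by (auto simp: alg_Hom_def)
    then have "act (max c) (interp A s xs) = interp A s xs"
      using c(3) by simp
    moreover have "interp A s xs \<in> carr A"
      using A s xsA by (simp add: is_algebra_def)
    ultimately show ?thesis
      using c(1,2) unfolding carr_stable by blast
  qed
  moreover have "interp stable = interp A"
    by (simp add: stable_def)
  ultimately show ?thesis
    by (auto simp: subalgebra_def is_algebra_def carr_stable)
qed

lemma clip_to_stable:
  assumes "0 < c" "c \<le> 1"
  shows "act (max c) \<in> alg_Hom \<Sigma> ar A stable"
proof -
  have "act (max c) a \<in> carr stable" if "a \<in> carr A" for a
    using clip_clip[of c c a] act_in_carr[OF clip_maps(1) clip_maps(2), of c a] assms that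
    by (auto simp: carr_stable)
  then show ?thesis
    using act_Hom[OF clip_maps(1) clip_maps(2), of c] assms
    by (auto simp: alg_Hom_def stable_def PiE_iff)
qed

text \<open>Let \<open>F Z \<cong> stable\<close>. By fullness, the corestricted clipping maps \<open>A \<rightarrow> stable\<close> come from arrows
  \<open>q c : Z \<rightarrow> I\<close>, and the inclusion of \<open>stable\<close> into \<open>A\<close> comes from an arrow \<open>w : I \<rightarrow> Z\<close>. The arrows \<open>q c\<close>
  have a limit \<open>p : Z \<rightarrow> I\<close>. Since \<open>q c \<circ> w\<close> is clipping at \<open>c\<close> for every \<open>c\<close>, the composite \<open>p \<circ> w\<close> is the
  identity; dually, the inclusion of \<open>stable\<close> has a section and is onto.\<close>

lemma interval_stable:
  assumes "a \<in> carr A"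
  obtains c where "0 < c" "c \<le> 1" "act (max c) a = a"
proof -
  note I = interval_Obj
  have "carr stable \<noteq> {}"
    using clip_to_stable[of 1] assms by (auto simp: alg_Hom_def)
  then have BK: "stable \<in> K"
    using SP stable_subalgebra Fo_K[OF I] unfolding SP_class_def by blast
  obtain Z \<beta> where Z: "Z \<in> Obj KH_le" and iso: "is_iso (alg_category \<Sigma> ar K) (Fo Z) stable \<beta>"
    using es BK by (auto simp: essentially_surjective_def alg_category_def opposite_def)
  then obtain \<gamma> where \<beta>: "\<beta> \<in> alg_Hom \<Sigma> ar (Fo Z) stable" and \<gamma>: "\<gamma> \<in> alg_Hom \<Sigma> ar stable (Fo Z)"
    and \<beta>\<gamma>: "compose (carr stable) \<beta> \<gamma> = (\<lambda>b\<in>carr stable. b)"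
    by (auto simp: is_iso_def alg_category_def)
  have \<beta>\<gamma>': "\<beta> (\<gamma> b) = b" if "b \<in> carr stable" for b
    using fun_cong[OF \<beta>\<gamma>, of b] that by (simp add: compose_eq)
  have "\<beta> \<in> alg_Hom \<Sigma> ar (Fo Z) A"
    using \<beta> by (auto simp: alg_Hom_def stable_def PiE_iff)
  then obtain w where w: "w \<in> KH_le_Hom interval Z" "Fm Z interval w = \<beta>"
    using Fm_full[OF I Z] by blast
  have "\<exists>q. q \<in> KH_le_Hom Z interval \<and> Fm interval Z q = compose (carr A) \<gamma> (act (max c))"
    if "0 < c" "c \<le> 1" for c
    using Fm_full[OF Z I alg_compose[OF Fo_K[OF I] BK Fo_K[OF Z] clip_to_stable[OF that] \<gamma>]] by metis
  then obtain q where q: "\<And>c. 0 < c \<Longrightarrow> c \<le> 1 \<Longrightarrow> q c \<in> KH_le_Hom Z interval"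
    and Fq: "\<And>c. 0 < c \<Longrightarrow> c \<le> 1 \<Longrightarrow> Fm interval Z (q c) = compose (carr A) \<gamma> (act (max c))"
    by metis
  have clip: "lift (max c) \<in> KH_le_Hom interval interval" if "0 < c" "c \<le> 1" for c
    using lift_Hom[OF clip_maps(1) clip_maps(2)] that by simp
  have "compose (topspace (fst Z)) (lift (max d)) (q c) = q d"
    if cd: "0 < c" "c \<le> d" "d \<le> 1" for c d
  proof (rule Fm_inj[OF Z I])
    have c: "c \<le> 1" and d: "0 < d"
      using cd by auto
    have "Fm interval Z (compose (topspace (fst Z)) (lift (max d)) (q c)) =
        compose (carr A) (compose (carr A) \<gamma> (act (max c))) (act (max d))"
      using Fm_compose[OF Z I I q[OF cd(1) c] clip[OF d cd(3)]] Fq[OF cd(1) c] by simp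
    also have "\<dots> = compose (carr A) \<gamma> (act (max d))"
      using clip_clip[of c d] act_in_carr[OF clip_maps(1) clip_maps(2), of d] cd c d
      by (auto simp: compose_def restrict_def fun_eq_iff max_absorb2)
    finally show "Fm interval Z (compose (topspace (fst Z)) (lift (max d)) (q c)) = Fm interval Z (q d)"
      using Fq[OF d cd(3)] by simp
    show "compose (topspace (fst Z)) (lift (max d)) (q c) \<in> KH_le_Hom Z interval"
      using KH_le_compose[OF Z I I q[OF cd(1) c] clip[OF d cd(3)]] .
    show "q d \<in> KH_le_Hom Z interval"
      using q[OF d cd(3)] .
  qed
  then obtain p where p: "p \<in> KH_le_Hom Z interval"
    and pq: "\<And>c. 0 < c \<Longrightarrow> c \<le> 1 \<Longrightarrow> compose (topspace (fst Z)) (lift (max c)) p = q c"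
    by (rule clip_limit[of q Z, rotated]) (use q in blast)+
  have qw: "compose pts (q c) w = lift (max c)" if c: "0 < c" "c \<le> 1" for c
  proof (rule Fm_inj[OF I I])
    show "compose pts (q c) w \<in> KH_le_Hom interval interval"
      using KH_le_compose[OF I Z I w(1) q[OF c]] by simp
    show "lift (max c) \<in> KH_le_Hom interval interval"
      using clip[OF c] .
    have "Fm interval interval (compose pts (q c) w) =
        compose (carr A) \<beta> (compose (carr A) \<gamma> (act (max c)))"
      using Fm_compose[OF I Z I w(1) q[OF c]] w(2) Fq[OF c] by simp
    also have "\<dots> = act (max c)"
      using clip_to_stable[OF c] \<beta>\<gamma>'
      by (intro extensionalityI[of _ "carr A"]) (auto simp: compose_eq alg_Hom_def PiE_iff)
    finally show "Fm interval interval (compose pts (q c) w) = act (max c)" .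
  qed
  have w_img: "w x \<in> topspace (fst Z)" if "x \<in> pts" for x
    using w(1) that by (auto simp: KH_le_Hom_def interval_def topspace_pullback_topology continuous_map_def split: prod.splits)
  have pw: "p (w x) = x" if x: "x \<in> pts" for x
  proof -
    have px: "p (w x) \<in> pts"
      using p w_img[OF x] by (auto simp: to_interval_iff)
    have "max c (val (p (w x))) = max c (val x)" if c: "0 < c" "c \<le> 1" for c
    proof -
      have "lift (max c) (p (w x)) = q c (w x)"
        using fun_cong[OF pq[OF c], of "w x"] w_img[OF x] by (simp add: compose_eq)
      also have "\<dots> = lift (max c) x"
        using fun_cong[OF qw[OF c], of x] x by (simp add: compose_eq)
      finally have "val (lift (max c) (p (w x))) = val (lift (max c) x)"
        by simp
      then show ?thesis
        using px x by (simp add: lift_def)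
    qed
    then have "val (p (w x)) = val x"
      using clip_determines val_range[OF px] val_range[OF x] by blast
    then show ?thesis
      using emb_val[OF px] emb_val[OF x] by simp
  qed
  have "compose pts p w = (\<lambda>x\<in>pts. x)"
    using pw by (auto simp: compose_def restrict_def)
  then have "compose (carr A) \<beta> (Fm interval Z p) = (\<lambda>a\<in>carr A. a)"
    using Fm_compose[OF I Z I w(1) p] w(2) Fm_ident[OF I] by simp
  from fun_cong[OF this, of a] have "\<beta> (Fm interval Z p a) = a"
    using assms by (simp add: compose_eq)
  moreover have "Fm interval Z p a \<in> carr (Fo Z)"
    using Fm_Hom[OF Z I p] assms by (auto simp: alg_Hom_def)
  moreover have "\<beta> \<in> carr (Fo Z) \<rightarrow> carr stable"
    using \<beta> by (auto simp: alg_Hom_def)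
  ultimately have "a \<in> carr stable"
    by (metis funcset_mem)
  then show thesis
    using that by (auto simp: carr_stable)
qed

text \<open>Clipping at \<open>c\<close> collapses \<open>[0,c]\<close> to the point \<open>c\<close>.\<close>

lemma point_values_near_zero:
  assumes "a \<in> carr A"
  obtains c where "0 < c" "\<And>t. 0 \<le> t \<Longrightarrow> t \<le> c \<Longrightarrow> t \<le> 1 \<Longrightarrow> act (\<lambda>_. t) a = act (\<lambda>_. 0) a"
proof -
  obtain c where c: "0 < c" "c \<le> 1" "act (max c) a = a"
    using interval_stable[OF assms] .
  have "act (\<lambda>_. t) a = act (\<lambda>_. c) a" if "0 \<le> t" "t \<le> c" for t
    using act_act[OF _ _ clip_maps(1) clip_maps(2) assms, of "\<lambda>_. t" c] c that
    by (simp add: max_absorb1)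
  from this[of 0] this show thesis
    using that[of c] c(1) by (metis less_imp_le order_refl)
qed

text \<open>The behaviour near \<open>0\<close> is transferred to the right and to the left of a point \<open>s\<close> by the maps
  \<open>t \<mapsto> s + t\<close> and \<open>t \<mapsto> s - t\<close>, truncated so that they stay inside the interval.\<close>

lemma point_values_constant:
  assumes a: "a \<in> carr A"
  shows "act (\<lambda>_. 0) a = act (\<lambda>_. 1) a"
proof (rule connected_local_const[of "{0..1::real}"])
  show "\<forall>s\<in>{0..1::real}. eventually (\<lambda>t. act (\<lambda>_. s) a = act (\<lambda>_. t) a) (at s within {0..1})"
  proof
    fix s :: real
    assume s: "s \<in> {0..1}"
    define f g where "f t = min 1 (s + t)" and "g t = max 0 (s - t)" for t :: real
    have f: "continuous_on {0..1} f" "f \<in> {0..1} \<rightarrow> {0..1}"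
      and g: "continuous_on {0..1} g" "g \<in> {0..1} \<rightarrow> {0..1}"
      unfolding f_def g_def using s by (auto intro!: continuous_intros)
    have shift: "act (\<lambda>_. t) (act h a) = act (\<lambda>_. h t) a"
      if "continuous_on {0..1} h" "h \<in> {0..1} \<rightarrow> {0..1}" "t \<in> {0..1}" for h t
      using act_act[OF _ _ that(1,2) a, of "\<lambda>_. t"] that(3) by simp
    obtain c where c: "0 < c"
      "\<And>t. 0 \<le> t \<Longrightarrow> t \<le> c \<Longrightarrow> t \<le> 1 \<Longrightarrow> act (\<lambda>_. t) (act f a) = act (\<lambda>_. 0) (act f a)"
      using point_values_near_zero[OF act_in_carr[OF f a]] by blast
    obtain d where d: "0 < d"
      "\<And>t. 0 \<le> t \<Longrightarrow> t \<le> d \<Longrightarrow> t \<le> 1 \<Longrightarrow> act (\<lambda>_. t) (act g a) = act (\<lambda>_. 0) (act g a)"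
      using point_values_near_zero[OF act_in_carr[OF g a]] by blast
    have "act (\<lambda>_. s) a = act (\<lambda>_. t) a" if "t \<in> {0..1}" "dist t s < min c d" for t
    proof (cases "s \<le> t")
      case True
      then show ?thesis
        using c(2)[of "t - s"] shift[OF f, of "t - s"] shift[OF f, of 0] that s
        by (simp add: f_def dist_real_def)
    next
      case False
      then show ?thesis
        using d(2)[of "s - t"] shift[OF g, of "s - t"] shift[OF g, of 0] that s
        by (simp add: g_def dist_real_def)
    qed
    then show "eventually (\<lambda>t. act (\<lambda>_. s) a = act (\<lambda>_. t) a) (at s within {0..1})"
      unfolding eventually_at using c(1) d(1) by (intro exI[of _ "min c d"]) auto
  qed
qed auto

lemma no_finitary_duality: False
proof -
  have const: "lift (\<lambda>_. t) \<in> KH_le_Hom interval interval" if "t \<in> {0..1}" for t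
    using that by (intro lift_Hom) auto
  have "act (\<lambda>_. 0) = act (\<lambda>_. 1)"
    using act_Hom[of "\<lambda>_. 0"] act_Hom[of "\<lambda>_. 1"] point_values_constant
    by (intro extensionalityI[of _ "carr A"]) (auto simp: alg_Hom_def PiE_iff)
  then have "lift (\<lambda>_. 0) = lift (\<lambda>_. 1)"
    using Fm_inj[OF interval_Obj interval_Obj] const by simp
  from lift_eqD[OF this, of 0] show False
    by simp
qed

end

theorem corollary22:
  fixes \<Sigma> :: "'f set"
    and ar :: "'f \<Rightarrow> nat"
    and K :: "('f, 'v) alg set"
  assumes "|UNIV :: real set| <o |UNIV :: 'u set|"
    and "SP_class \<Sigma> ar K"
  shows "\<not> equivalent_categories
           (opposite (KH_le :: ('u ordered_space, 'u \<Rightarrow> 'u) category))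
           (alg_category \<Sigma> ar K)"
proof
  assume eq: "equivalent_categories
    (opposite (KH_le :: ('u ordered_space, 'u \<Rightarrow> 'u) category)) (alg_category \<Sigma> ar K)"
  obtain Fo Fm where F:
    "is_functor (opposite (KH_le :: ('u ordered_space, 'u \<Rightarrow> 'u) category)) (alg_category \<Sigma> ar K) Fo Fm"
    "fully_faithful (opposite KH_le) (alg_category \<Sigma> ar K) Fo Fm"
    "essentially_surjective (opposite KH_le) (alg_category \<Sigma> ar K) Fo"
    using equivalence_fully_faithful_essentially_surjective[OF
        is_category_opposite[OF is_category_KH_le] is_category_alg_category[OF assms(2)] eq] .
  obtain emb :: "real \<Rightarrow> 'u" where "inj emb"
    using ordLess_imp_ordLeq[OF assms(1)] unfolding card_of_ordLeq[symmetric] by auto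
  then interpret finitary_duality emb \<Sigma> ar K Fo Fm
    using assms F by unfold_locales
  show False
    by (rule no_finitary_duality)
qed

end
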